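(* Let $f\colon\mathbb{R}^p\to(-\infty,\infty]$ be a convex function, and let $B\colon\mathbb{R}^n\to\mathbb{R}^p$ be the affine mapping $B(x):=Ax+b$, where $A$ is a $p\times n$ matrix and $b\in\mathbb{R}^p$. Let $\bar{x}\in\mathbb{R}^n$ be such that $B(\bar{x})\in\mathrm{dom}(f)$, and denote $\bar{y}:=B(\bar{x})$. Assume that the range of $B$ contains a point of $\mathrm{ri}(\mathrm{dom}(f))$. Then $$\partial(f\circ B)(\bar{x})=A^\top\big(\partial f(\bar{y})\big)=\big\{A^\top v : v\in\partial f(\bar{y})\big\}.$$
   Context: For $f\colon\mathbb{R}^p\to(-\infty,\infty]$, $\mathrm{dom}(f):=\{x : f(x)<\infty\}$. For a convex function $f$ and $\bar{x}\in\mathrm{dom}(f)$, the subdifferential is $\partial f(\bar{x}):=\{v : f(x)\ge f(\bar{x})+\langle v,x-\bar{x}\rangle\text{ for all }x\}$. For a convex set $\Omega$, the relative interior $\mathrm{ri}(\Omega)$ is the set of $x\in\Omega$ for which there is $\gamma>0$ with $\mathbb{B}(x;\gamma)\cap\mathrm{aff}(\Omega)\subset\Omega$ (closed ball, affine hull). *)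

theory Defs
  imports "HOL-Analysis.Analysis"
begin

definition effective_domain :: "('a \<Rightarrow> ereal) \<Rightarrow> 'a set" where
  "effective_domain f = {x. f x < \<infinity>}"

(* Intended for functions that never take the value -\<infinity>, so that the sum on the
   right is never \<infinity> + (-\<infinity>).  The weight t is kept strictly between 0 and 1
   because 0 * \<infinity> = 0 in ereal.  The library's convex_on covers only
   functions with values in an ordered real vector space, which ereal is not. *)
definition convex_ereal :: "('a::real_vector \<Rightarrow> ereal) \<Rightarrow> bool" where
  "convex_ereal f \<longleftrightarrow>
    (\<forall>x y. \<forall>t::real. 0 < t \<and> t < 1 \<longrightarrow>
      f (t *\<^sub>R x + (1 - t) *\<^sub>R y) \<le> ereal t * f x + ereal (1 - t) * f y)"

(* Meaningful for f with values above -\<infinity> and xbar in the effective domain of f. *)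
definition subdifferential :: "('a::real_inner \<Rightarrow> ereal) \<Rightarrow> 'a \<Rightarrow> 'a set" where
  "subdifferential f xbar = {v. \<forall>x. f x \<ge> f xbar + ereal (v \<bullet> (x - xbar))}"

end

theory Submission
  imports Defs
begin

text \<open>
  One inclusion of the chain rule only rewrites the subgradient inequality with the adjoint of
  the linear part \<open>L\<close> of the affine map (\<open>subdifferential_affine_comp_supset\<close>).

  For the other one, let \<open>v\<close> be a subgradient of the composition at \<open>x\<close> and put
  \<open>y\<^sub>x = L x + b\<close>. Perturb the affine map by a translation \<open>z\<close> and consider
  \[ g(z) = \inf_u \; f(y_x + z + L u) - \langle v, u\rangle. \]
  The function \<open>g\<close> is convex, and the subgradient inequality for \<open>v\<close> says that
  \<open>g 0 = f y\<^sub>x\<close>. If \<open>w\<close> is a subgradient of \<open>g\<close> at \<open>0\<close>, then for all \<open>y\<close> and \<open>u\<close>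
  \[ f(y) \ge f(y_x) + \langle w, y - y_x - L u\rangle + \langle v, u\rangle. \]
  Taking \<open>u = 0\<close> shows that \<open>w\<close> is a subgradient of \<open>f\<close> at \<open>y\<^sub>x\<close>; taking \<open>y = y\<^sub>x\<close> and \<open>u\<close>
  arbitrary forces \<open>v\<close> to be the adjoint of \<open>L\<close> applied to \<open>w\<close>.

  The existence of \<open>w\<close> is where the qualification enters. A supporting hyperplane of the
  epigraph of \<open>g\<close> at \<open>(0, g 0)\<close> always exists, but it might be vertical. It is not, because a
  point of the relative interior of the domain of \<open>f\<close> in the range of the affine map makes
  \<open>0\<close> a relative interior point of the domain of \<open>g\<close>
  (\<open>nonvertical_supporting_hyperplane\<close>). The proof works with a convex set \<open>D\<close> between the
  strict epigraph of \<open>g\<close> and its epigraph instead of \<open>g\<close> itself, which avoids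
  infima that may be infinite.
\<close>

text \<open>
  A vertical hyperplane supporting \<open>D\<close> at \<open>(0, m)\<close> would be given by a functional \<open>c\<close> that is
  nonnegative on the projection of \<open>D\<close>. The last hypothesis, which says that \<open>0\<close> is a relative
  interior point of this convex projection, makes \<open>c\<close> vanish there, so \<open>D\<close> would lie inside the
  hyperplane. The hyperplane can be chosen not to contain \<open>D\<close>, and hence is the graph of an
  affine function.
\<close>
lemma nonvertical_supporting_hyperplane:
  fixes D :: "('a::euclidean_space \<times> real) set"
  assumes convex: "convex D"
    and upward: "\<And>z r s. (z, r) \<in> D \<Longrightarrow> r \<le> s \<Longrightarrow> (z, s) \<in> D"
    and mem: "(0, m) \<in> D"
    and lower: "\<And>r. (0, r) \<in> D \<Longrightarrow> m \<le> r"
    and opposite: "\<And>z r. (z, r) \<in> D \<Longrightarrow> \<exists>t>0. \<exists>s. (- t *\<^sub>R z, s) \<in> D"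
  obtains w where "\<And>z r. (z, r) \<in> D \<Longrightarrow> m + w \<bullet> z \<le> r"
proof -
  have not_rel_interior: "(0, m) \<notin> rel_interior D"
  proof
    assume "(0, m) \<in> rel_interior D"
    moreover have "D \<noteq> {}"
      using mem by auto
    ultimately have "\<forall>p\<in>D. \<exists>e>1. (1 - e) *\<^sub>R p + e *\<^sub>R (0, m) \<in> D"
      using convex_rel_interior_iff[OF convex] by simp
    moreover have "(0, m + 1) \<in> D"
      by (rule upward[OF mem]) simp
    ultimately obtain e where "e > 1"
      and "(1 - e) *\<^sub>R (0, m + 1) + e *\<^sub>R (0, m) \<in> D"
      by blast
    \<comment> \<open>The prolongation of the vertical segment beyond \<open>(0, m)\<close> goes below the lowest point.\<close>
    then have "(0, m + 1 - e) \<in> D"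
      by (simp add: algebra_simps)
    then show False
      using lower \<open>e > 1\<close> by force
  qed
  obtain a where
    a_le: "\<And>p. p \<in> D \<Longrightarrow> a \<bullet> (0, m) \<le> a \<bullet> p" and
    a_less: "\<And>p. p \<in> rel_interior D \<Longrightarrow> a \<bullet> (0, m) < a \<bullet> p"
    using supporting_hyperplane_rel_boundary[OF convex mem not_rel_interior] by metis
  obtain c \<beta> where a: "a = (c, \<beta>)"
    by (cases a)
  have bound: "\<beta> * m \<le> c \<bullet> z + \<beta> * r" if "(z, r) \<in> D" for z r
    using a_le[OF that] by (auto simp: a)
  have "\<beta> \<ge> 0"
    using bound[of 0 "m + 1"] upward[OF mem, of "m + 1"] by (simp add: algebra_simps)
  moreover have "\<beta> \<noteq> 0"
  proof
    assume "\<beta> = 0"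
    obtain z r where zr: "(z, r) \<in> rel_interior D"
      using rel_interior_eq_empty[OF convex] mem by (metis ex_in_conv prod.exhaust)
    then have "c \<bullet> z > 0"
      using a_less[OF zr] by (simp add: a \<open>\<beta> = 0\<close>)
    moreover obtain t s where "t > 0" and "(- t *\<^sub>R z, s) \<in> D"
      using opposite[of z r] zr rel_interior_subset[of D] by blast
    then have "t * (c \<bullet> z) \<le> 0"
      using bound[of "- t *\<^sub>R z" s] by (simp add: \<open>\<beta> = 0\<close>)
    ultimately show False
      using \<open>t > 0\<close> by (simp add: mult_le_0_iff)
  qed
  ultimately have "\<beta> > 0"
    by simp
  then have "m + (- (1 / \<beta>) *\<^sub>R c) \<bullet> z \<le> r" if "(z, r) \<in> D" for z r
    using bound[OF that] by (simp add: field_simps)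
  then show thesis
    using that by blast
qed

lemma convex_epigraph_ereal:
  assumes "convex_ereal f"
  shows "convex {(y, \<alpha>). f y \<le> ereal \<alpha>}"
proof (rule convexI)
  fix p q :: "'a \<times> real" and s t :: real
  assume "p \<in> {(y, \<alpha>). f y \<le> ereal \<alpha>}" "q \<in> {(y, \<alpha>). f y \<le> ereal \<alpha>}"
  then obtain y \<alpha> z \<beta> where p: "p = (y, \<alpha>)" and y: "f y \<le> ereal \<alpha>"
    and q: "q = (z, \<beta>)" and z: "f z \<le> ereal \<beta>"
    by auto
  assume st: "0 \<le> s" "0 \<le> t" "s + t = 1"
  have "f (s *\<^sub>R y + t *\<^sub>R z) \<le> ereal (s * \<alpha> + t * \<beta>)"
  proof (cases "s = 0 \<or> t = 0")
    case True
    then show ?thesis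
      using y z st by auto
  next
    case False
    then have s: "0 < s" "s < 1" and t: "t = 1 - s"
      using st by auto
    have "f (s *\<^sub>R y + t *\<^sub>R z) \<le> ereal s * f y + ereal t * f z"
      using assms s unfolding convex_ereal_def t by blast
    also have "\<dots> \<le> ereal s * ereal \<alpha> + ereal t * ereal \<beta>"
      using y z st by (intro add_mono ereal_mult_left_mono) auto
    finally show ?thesis
      by simp
  qed
  then show "s *\<^sub>R p + t *\<^sub>R q \<in> {(y, \<alpha>). f y \<le> ereal \<alpha>}"
    by (simp add: p q)
qed

lemma effective_domain_eq_fst_epigraph:
  "effective_domain f = fst ` {(y, \<alpha>). f y \<le> ereal \<alpha>}"
proof -
  have "(\<exists>\<alpha>. f y \<le> ereal \<alpha>) \<longleftrightarrow> f y < \<infinity>" for y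
    by (cases "f y") auto
  then show ?thesis
    by (force simp: effective_domain_def image_iff)
qed

lemma convex_effective_domain:
  assumes "convex_ereal f"
  shows "convex (effective_domain f)"
  unfolding effective_domain_eq_fst_epigraph
  by (rule convex_linear_image[OF linear_fst convex_epigraph_ereal[OF assms]])

lemma subdifferential_affine_comp_supset:
  fixes L :: "'a::euclidean_space \<Rightarrow> 'b::euclidean_space"
  assumes "linear L" and "w \<in> subdifferential f (L x + b)"
  shows "adjoint L w \<in> subdifferential (\<lambda>x. f (L x + b)) x"
  unfolding subdifferential_def
proof (clarify)
  fix u
  have "f (L u + b) \<ge> f (L x + b) + ereal (w \<bullet> ((L u + b) - (L x + b)))"
    using assms(2) unfolding subdifferential_def by blast
  moreover have "w \<bullet> ((L u + b) - (L x + b)) = adjoint L w \<bullet> (u - x)"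
    by (simp add: adjoint_clauses[OF \<open>linear L\<close>] linear_diff[OF \<open>linear L\<close>])
  ultimately show "f (L x + b) + ereal (adjoint L w \<bullet> (u - x)) \<le> f (L u + b)"
    by simp
qed

text \<open>
  The required \<open>w\<close> is a subgradient at \<open>0\<close> of the convex function that sends a translation \<open>z\<close>
  to the infimum of \<open>f (L x + b + z + L u) - v \<bullet> u\<close> over all \<open>u\<close>.
\<close>
lemma subdifferential_affine_comp_lift:
  fixes L :: "'a::euclidean_space \<Rightarrow> 'b::euclidean_space"
  assumes "linear L"
    and f_gt: "\<And>y. f y > -\<infinity>"
    and f_convex: "convex_ereal f"
    and dom: "L x + b \<in> effective_domain f"
    and x0: "L x0 + b \<in> rel_interior (effective_domain f)"
    and v: "v \<in> subdifferential (\<lambda>x. f (L x + b)) x"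
  shows "\<exists>w \<in> subdifferential f (L x + b). v = adjoint L w"
proof -
  interpret linear L by fact
  let ?y = "L x + b"
  obtain m where m: "f ?y = ereal m"
    using dom f_gt[of ?y] by (cases "f ?y") (auto simp: effective_domain_def)
  have v_le: "m + v \<bullet> u \<le> \<alpha>" if "f (?y + L u) \<le> ereal \<alpha>" for u \<alpha>
  proof -
    have "f ?y + ereal (v \<bullet> (x + u - x)) \<le> f (L (x + u) + b)"
      using v unfolding subdifferential_def by blast
    also have "L (x + u) + b = ?y + L u"
      by (simp add: add)
    also note that
    finally show ?thesis
      by (simp add: m)
  qed
  \<comment> \<open>\<open>D\<close> stands for the epigraph of this infimum as a function of \<open>z\<close>. It is defined as a translate
    of a linear image of a convex set, which makes its convexity evident; its points are described by \<open>D_iff\<close>.\<close>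
  define E where "E = {(y, \<alpha>). f y \<le> ereal \<alpha>}"
  define \<phi> where "\<phi> = (\<lambda>((y, \<alpha>), u). (y - L u, \<alpha> - v \<bullet> u))"
  define D where "D = (+) (- ?y, 0) ` \<phi> ` (E \<times> (UNIV :: 'a set))"
  have D_iff: "(z, r) \<in> D \<longleftrightarrow> (\<exists>u. f (?y + z + L u) \<le> ereal (r + v \<bullet> u))" for z r
  proof
    assume "(z, r) \<in> D"
    then obtain y \<alpha> u where "f y \<le> ereal \<alpha>" "z = y - L u - ?y" "r = \<alpha> - v \<bullet> u"
      unfolding D_def E_def \<phi>_def by auto
    then show "\<exists>u. f (?y + z + L u) \<le> ereal (r + v \<bullet> u)"
      by (auto intro!: exI[of _ u])
  next
    assume "\<exists>u. f (?y + z + L u) \<le> ereal (r + v \<bullet> u)"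
    then obtain u where "f (?y + z + L u) \<le> ereal (r + v \<bullet> u)" ..
    then have "((?y + z + L u, r + v \<bullet> u), u) \<in> E \<times> UNIV"
      by (simp add: E_def)
    then have "(- ?y, 0) + \<phi> ((?y + z + L u, r + v \<bullet> u), u) \<in> D"
      unfolding D_def by blast
    then show "(z, r) \<in> D"
      by (simp add: \<phi>_def)
  qed
  have "linear \<phi>"
    by (rule linearI) (auto simp: \<phi>_def add scale algebra_simps inner_simps)
  have "convex E"
    unfolding E_def by (rule convex_epigraph_ereal[OF f_convex])
  then have "convex D"
    unfolding D_def
    by (intro convex_translation convex_linear_image[OF \<open>linear \<phi>\<close>] convex_Times convex_UNIV)
  moreover have "(z, s) \<in> D" if "(z, r) \<in> D" "r \<le> s" for z r s
  proof -
    obtain u where "f (?y + z + L u) \<le> ereal (r + v \<bullet> u)"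
      using \<open>(z, r) \<in> D\<close> unfolding D_iff by auto
    also have "\<dots> \<le> ereal (s + v \<bullet> u)"
      using that by simp
    finally show ?thesis
      unfolding D_iff by (rule exI[of _ u])
  qed
  moreover have "(0, m) \<in> D"
    unfolding D_iff by (rule exI[of _ 0]) (simp add: m zero)
  moreover have "m \<le> r" if "(0, r) \<in> D" for r
    using that v_le unfolding D_iff by fastforce
  moreover have "\<exists>t>0. \<exists>s. (- t *\<^sub>R z, s) \<in> D" if zr: "(z, r) \<in> D" for z r
  proof -
    obtain u where u: "f (?y + z + L u) \<le> ereal (r + v \<bullet> u)"
      using zr unfolding D_iff by auto
    then have in_dom: "?y + z + L u \<in> effective_domain f"
      by (auto simp: effective_domain_def)
    \<comment> \<open>The segment from this point to \<open>L x0 + b\<close> can be prolonged within the domain. Since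
      \<open>L x0 + b\<close> and \<open>?y\<close> differ by an element of the range of \<open>L\<close>, the new end point is
      \<open>?y - (e - 1) z\<close> modulo that range.\<close>
    then obtain e where "e > 1"
      and "(1 - e) *\<^sub>R (?y + z + L u) + e *\<^sub>R (L x0 + b) \<in> effective_domain f"
      using convex_rel_interior_iff[OF convex_effective_domain[OF f_convex]] x0 by blast
    moreover have "(1 - e) *\<^sub>R (?y + z + L u) + e *\<^sub>R (L x0 + b)
        = ?y + (1 - e) *\<^sub>R z + L ((1 - e) *\<^sub>R u + e *\<^sub>R (x0 - x))"
      by (simp add: add diff scale algebra_simps)
    ultimately obtain \<alpha> where
      "f (?y + (1 - e) *\<^sub>R z + L ((1 - e) *\<^sub>R u + e *\<^sub>R (x0 - x))) \<le> ereal \<alpha>"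
      unfolding effective_domain_eq_fst_epigraph by auto
    then have "((1 - e) *\<^sub>R z, \<alpha> - v \<bullet> ((1 - e) *\<^sub>R u + e *\<^sub>R (x0 - x))) \<in> D"
      unfolding D_iff by (intro exI[of _ "(1 - e) *\<^sub>R u + e *\<^sub>R (x0 - x)"]) simp
    then show ?thesis
      using \<open>e > 1\<close> by (intro exI[of _ "e - 1"]) auto
  qed
  ultimately obtain w where w: "\<And>z r. (z, r) \<in> D \<Longrightarrow> m + w \<bullet> z \<le> r"
    by (rule nonvertical_supporting_hyperplane[of D m]) blast+
  have key: "m + w \<bullet> (y - ?y - L u) + v \<bullet> u \<le> \<alpha>" if "f y \<le> ereal \<alpha>" for y u \<alpha>
  proof -
    have "(y - ?y - L u, \<alpha> - v \<bullet> u) \<in> D"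
      unfolding D_iff using that by (intro exI[of _ u]) simp
    from w[OF this] show ?thesis
      by simp
  qed
  have "w \<in> subdifferential f ?y"
    unfolding subdifferential_def
  proof (clarify)
    fix y
    show "f ?y + ereal (w \<bullet> (y - ?y)) \<le> f y"
      using key[of y _ 0] f_gt[of y] by (cases "f y") (auto simp: m zero)
  qed
  moreover have "v = adjoint L w"
  proof -
    have "(v - adjoint L w) \<bullet> u \<le> 0" for u
      using key[of ?y m u] m
      by (simp add: inner_diff_left inner_diff_right adjoint_clauses[OF \<open>linear L\<close>])
    from this[of "v - adjoint L w"] show ?thesis
      by (metis inner_gt_zero_iff not_less eq_iff_diff_eq_0)
  qed
  ultimately show ?thesis
    by blast
qed

theorem theorem7p2:
  fixes f :: "real ^ 'p \<Rightarrow> ereal"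
    and A :: "real ^ 'n ^ 'p"
    and b :: "real ^ 'p"
    and B :: "real ^ 'n \<Rightarrow> real ^ 'p"
    and xbar :: "real ^ 'n"
    and ybar :: "real ^ 'p"
  assumes f_gt: "\<And>y. f y > -\<infinity>"
    and f_convex: "convex_ereal f"
    and B_def: "\<And>x. B x = A *v x + b"
    and xbar_dom: "B xbar \<in> effective_domain f"
    and ybar_def: "ybar = B xbar"
    and qualification: "range B \<inter> rel_interior (effective_domain f) \<noteq> {}"
  shows "subdifferential (f \<circ> B) xbar = (\<lambda>v. transpose A *v v) ` subdifferential f ybar
    \<and> (\<lambda>v. transpose A *v v) ` subdifferential f ybar
           = {transpose A *v v | v. v \<in> subdifferential f ybar}"
proof
  have linear: "linear ((*v) A)"
    by (rule matrix_vector_mul_linear)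
  have adjoint: "adjoint ((*v) A) = (*v) (transpose A)"
    by (rule adjoint_matrix)
  have comp: "f \<circ> B = (\<lambda>x. f (A *v x + b))"
    by (simp add: fun_eq_iff B_def)
  obtain x0 where "A *v x0 + b \<in> rel_interior (effective_domain f)"
    using qualification by (auto simp: B_def)
  then show "subdifferential (f \<circ> B) xbar = (\<lambda>v. transpose A *v v) ` subdifferential f ybar"
    using subdifferential_affine_comp_supset[OF linear]
      subdifferential_affine_comp_lift[OF linear f_gt f_convex] xbar_dom
    unfolding comp ybar_def B_def adjoint by blast
  show "(\<lambda>v. transpose A *v v) ` subdifferential f ybar
      = {transpose A *v v | v. v \<in> subdifferential f ybar}"
    by blast
qed

end
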